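(* Let $n>m\ge 1$ be co-prime integers and set $x_0:=(m/n)^{1/(n-m)}\in(0,1)$. Let $p,q:[0,\infty)\to\mathbb{R}$ be two right analytic functions of exponential order with $\inf\{x>0: p(x)\neq 0\}=0$ and $\inf\{x>0: q(x)\neq 0\}=0$, and with $p(0)=1$. Suppose that one of the following conditions holds: (1) for all $t>0$, $p(t)>x_0$ and $q(t)\ge x_0$; (2) for all $t>0$, $p(t)\ge 1$ and $q(t)>0$; (3) $n$ is odd, $m$ is even, and $p(t)>1$ for all $t>0$. If $H_{n,m}(p,\cdot)=H_{n,m}(q,\cdot)$, then $p=q$, i.e. $p(x)=q(x)$ for all $x\ge 0$.
   Context: A function $p:[0,\infty)\to\mathbb{R}$ is of exponential order if there exist $c>0$, $C>0$ with $|p(x)|\le Ce^{cx}$ for all $x\ge 0$; its Laplace transform is $\widehat p(\lambda)=\int_0^\infty e^{-\lambda x}p(x)\,dx$ for $\lambda$ with real part larger than $c$. The function $p$ is right analytic (on $[0,\infty)$) if it is right analytic at every point $s\ge 0$: there are $\delta>0$ and reals $a_0,a_1,\dots$ such that $p(t)=\sum_{i\ge 0}a_i(t-s)^i$ for all $t\in[s,s+\delta)$. For positive integers $n,m$, $H_{n,m}(p,\lambda):=\widehat{p^n}(\lambda)/\widehat{p^m}(\lambda)$, where $p^k$ is the pointwise $k$-th power. The equality $H_{n,m}(p,\cdot)=H_{n,m}(q,\cdot)$ means $H_{n,m}(p,\lambda)=H_{n,m}(q,\lambda)$ for all sufficiently large $\lambda$. *)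

theory Defs
  imports "HOL-Analysis.Analysis"
begin

text \<open>
  Functions on the half-line are represented by total functions on the reals; all notions below
  depend only on their values on \<open>{0..}\<close>.
\<close>

definition exponential_order :: "(real \<Rightarrow> real) \<Rightarrow> bool" where
  "exponential_order p \<longleftrightarrow> (\<exists>c>0. \<exists>C>0. \<forall>x\<ge>0. \<bar>p x\<bar> \<le> C * exp (c * x))"

definition right_analytic_at :: "(real \<Rightarrow> real) \<Rightarrow> real \<Rightarrow> bool" where
  "right_analytic_at p s \<longleftrightarrow>
     (\<exists>\<delta>>0. \<exists>a :: nat \<Rightarrow> real. \<forall>t\<in>{s..<s + \<delta>}. (\<lambda>i. a i * (t - s) ^ i) sums p t)"

definition right_analytic :: "(real \<Rightarrow> real) \<Rightarrow> bool" where
  "right_analytic p \<longleftrightarrow> (\<forall>s\<ge>0. right_analytic_at p s)"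

text \<open>
  The Bochner integral is 0 when the integrand is not integrable, so the value is meaningful only
  if the real part of \<open>z\<close> is large enough.
\<close>

definition laplace :: "(real \<Rightarrow> real) \<Rightarrow> complex \<Rightarrow> complex" where
  "laplace p z =
     set_lebesgue_integral lborel {0..} (\<lambda>x. exp (- z * complex_of_real x) * complex_of_real (p x))"

definition H :: "nat \<Rightarrow> nat \<Rightarrow> (real \<Rightarrow> real) \<Rightarrow> complex \<Rightarrow> complex" where
  "H n m p z = laplace (\<lambda>x. p x ^ n) z / laplace (\<lambda>x. p x ^ m) z"

text \<open>
  The infimum is taken in the extended reals, so that the infimum of the empty set is \<open>\<infinity>\<close> (it is an
  unspecified number in type \<open>real\<close>).
\<close>

definition first_nonzero :: "(real \<Rightarrow> real) \<Rightarrow> ereal" where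
  "first_nonzero p = Inf (ereal ` {x. x > 0 \<and> p x \<noteq> 0})"

end

theory Submission
  imports Defs "HOL-Probability.Distributions"
begin

text \<open>
  Write \<open>P\<^sub>j\<close>, \<open>Q\<^sub>j\<close> for the Laplace transforms of \<open>p ^ j\<close>, \<open>q ^ j\<close> along the real axis. Once the
  denominators are known not to vanish, the hypothesis reads \<open>P\<^sub>n Q\<^sub>m = P\<^sub>m Q\<^sub>n\<close> for large \<open>l\<close>. The
  idea is to compare the leading asymptotics of both sides as \<open>l\<close> tends to infinity: they show only
  the germ of an integrand at the first point where it does not vanish, and that is enough.

  The analytic tool is the leading term of Watson's lemma (\<open>real_laplace_leading_term\<close>): if \<open>h\<close>
  vanishes on \<open>{0..<s}\<close> and \<open>h t / (t - s) ^ k\<close> tends to \<open>F\<close> as \<open>t\<close> decreases to \<open>s\<close>, then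
  \<open>l ^ (k + 1) * exp (l * s)\<close> times the transform of \<open>h\<close> at \<open>l\<close> tends to \<open>F * fact k\<close>.

  Applied at \<open>s = 0\<close> to the powers of \<open>p\<close> and of \<open>q\<close>, where \<open>q t\<close> behaves like \<open>c * t ^ k\<close>, it shows
  that \<open>P\<^sub>n Q\<^sub>m\<close> decays like \<open>l ^ - (k m + 2)\<close> and \<open>P\<^sub>m Q\<^sub>n\<close> like \<open>l ^ - (k n + 2)\<close>. Hence \<open>k = 0\<close> and
  \<open>c ^ (n - m) = 1\<close>. Each condition makes \<open>q\<close> positive or \<open>n - m\<close> odd, so \<open>q 0 = c = 1\<close>.

  If \<open>p\<close> and \<open>q\<close> differ, let \<open>s\<close> be the infimum of the points where they do, and put \<open>a = p s\<close>,
  \<open>b = q s\<close>. Just to the right of \<open>s\<close>, right analyticity gives \<open>p t - q t\<close> the leading term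
  \<open>c * (t - s) ^ k\<close> with \<open>c \<noteq> 0\<close>. (The functions may jump at \<open>s\<close>, so \<open>k = 0\<close> is possible.) Then
  \<open>p t ^ j - q t ^ j\<close> has the coefficient \<open>c * D j\<close> at \<open>(t - s) ^ k\<close>, where \<open>D j\<close> is the divided difference
  \<open>(a ^ j - b ^ j) / (a - b)\<close>, read as \<open>j * a ^ (j - 1)\<close> if \<open>a = b\<close>. Comparing leading terms in
  \<open>(P\<^sub>n - Q\<^sub>n) Q\<^sub>m = (P\<^sub>m - Q\<^sub>m) Q\<^sub>n\<close>, where \<open>Q\<^sub>m\<close> and \<open>Q\<^sub>n\<close> are both asymptotic to \<open>1 / l\<close>, yields
  \<open>D n = D m\<close> (\<open>divided_differences_agree_at_first_discrepancy\<close>).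

  In terms of \<open>\<phi> x = x ^ n - x ^ m\<close> this says \<open>\<phi> a = \<phi> b\<close> if \<open>a \<noteq> b\<close>, and \<open>a\<close> is a critical point
  of \<open>\<phi>\<close> if \<open>a = b\<close>. But \<open>x0\<close> is the only positive critical point of \<open>\<phi>\<close>, which increases strictly
  beyond it, and each of the three conditions (for \<open>s = 0\<close>, the values \<open>a = b = 1\<close>)
  excludes both (\<open>power_divided_differences_differ\<close>).
\<close>

section \<open>Leading terms of right analytic functions\<close>

text \<open>
  The series converges only on the right of \<open>s\<close> by assumption, but a power series that converges at
  a point converges on the open disc bounded by it, so its sum is continuous at the centre.
\<close>

lemma powser_leading_coefficient_at_right:
  fixes a :: "nat \<Rightarrow> real"
  assumes "\<delta> > 0"
    and sums: "\<And>t. t \<in> {s..<s + \<delta>} \<Longrightarrow> (\<lambda>i. a i * (t - s) ^ i) sums f t"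
    and low: "\<And>i. i < k \<Longrightarrow> a i = 0"
  shows "((\<lambda>t. f t / (t - s) ^ k) \<longlongrightarrow> a k) (at_right s)"
proof -
  define g where "g u = (\<Sum>i. a (i + k) * u ^ i)" for u
  have tail: "(\<lambda>i. a (i + k) * u ^ i) sums (f (s + u) / u ^ k)" if "0 < u" "u < \<delta>" for u
  proof -
    have "(\<lambda>i. a i * u ^ i) sums f (s + u)"
      using sums[of "s + u"] that by simp
    moreover have "(\<Sum>i<k. a i * u ^ i) = 0"
      using low by simp
    ultimately have "(\<lambda>i. a (i + k) * u ^ (i + k)) sums f (s + u)"
      using sums_split_initial_segment[of "\<lambda>i. a i * u ^ i" "f (s + u)" k] by simp
    from sums_divide[OF this, of "u ^ k"] show ?thesis
      using that by (simp add: power_add field_simps)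
  qed
  have "(\<lambda>i. a (i + k) * u ^ i) sums g u" if "norm u < \<delta>" for u
  proof -
    define v where "v = (norm u + \<delta>) / 2"
    have "0 < v" "v < \<delta>" "norm u < norm v"
      using that \<open>\<delta> > 0\<close> by (auto simp: v_def field_simps abs_if)
    then have "summable (\<lambda>i. a (i + k) * u ^ i)"
      using tail[of v] by (intro powser_inside[of "\<lambda>i. a (i + k)" v u]) (auto simp: sums_iff)
    then show ?thesis
      by (simp add: g_def summable_sums)
  qed
  from powser_limit_0[OF \<open>\<delta> > 0\<close> this] have "(g \<longlongrightarrow> a k) (at_right 0)"
    by (simp add: filterlim_at_split)
  then have "((\<lambda>t. g (t - s)) \<longlongrightarrow> a k) (at_right s)"
    by (simp add: filterlim_at_right_to_0[of _ _ s])
  moreover have "\<forall>\<^sub>F t in at_right s. g (t - s) = f t / (t - s) ^ k"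
  proof -
    have "\<forall>\<^sub>F t in at_right s. t \<in> {s<..<s + \<delta>}"
      using \<open>\<delta> > 0\<close> by (intro eventually_at_right_real) simp
    then show ?thesis
    proof eventually_elim
      case (elim t)
      then show ?case
        using tail[of "t - s"] by (simp add: g_def sums_iff)
    qed
  qed
  ultimately show ?thesis
    by (rule Lim_transform_eventually)
qed

lemma right_analytic_at_tendsto:
  assumes "right_analytic_at f s"
  shows "(f \<longlongrightarrow> f s) (at_right s)"
proof -
  obtain \<delta> a where "\<delta> > 0" and sums: "\<And>t. t \<in> {s..<s + \<delta>} \<Longrightarrow> (\<lambda>i. a i * (t - s) ^ i) sums f t"
    using assms unfolding right_analytic_at_def by blast
  have "f s = a 0"
    using sums[of s] \<open>\<delta> > 0\<close> powser_sums_zero[of a] sums_unique2 by fastforce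
  moreover have "(f \<longlongrightarrow> a 0) (at_right s)"
    using powser_leading_coefficient_at_right[of \<delta> s a f 0] \<open>\<delta> > 0\<close> sums by simp
  ultimately show ?thesis by simp
qed

text \<open>
  A nonzero germ has a nonzero coefficient. The half-open interval includes \<open>s\<close>, so a germ with
  \<open>f s \<noteq> 0\<close> is covered too; it has \<open>k = 0\<close>.
\<close>

lemma right_analytic_at_leading_term:
  assumes "right_analytic_at f s"
    and nz: "\<And>\<epsilon>. \<epsilon> > 0 \<Longrightarrow> \<exists>t\<in>{s..<s + \<epsilon>}. f t \<noteq> 0"
  obtains k c where "c \<noteq> 0" "((\<lambda>t. f t / (t - s) ^ k) \<longlongrightarrow> c) (at_right s)"
proof -
  obtain \<delta> a where "\<delta> > 0" and sums: "\<And>t. t \<in> {s..<s + \<delta>} \<Longrightarrow> (\<lambda>i. a i * (t - s) ^ i) sums f t"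
    using assms unfolding right_analytic_at_def by blast
  have "\<exists>i. a i \<noteq> 0"
  proof (rule ccontr)
    assume "\<not> ?thesis"
    then have "f t = 0" if "t \<in> {s..<s + \<delta>}" for t
      using sums[OF that] by (simp add: sums_iff)
    with nz[OF \<open>\<delta> > 0\<close>] show False by auto
  qed
  then have "a (LEAST i. a i \<noteq> 0) \<noteq> 0"
    by (rule LeastI_ex)
  moreover have "a i = 0" if "i < (LEAST i. a i \<noteq> 0)" for i
    using not_less_Least[OF that] by simp
  ultimately show thesis
    using powser_leading_coefficient_at_right[OF \<open>\<delta> > 0\<close> sums] that by blast
qed

lemma right_analytic_at_diff:
  assumes "right_analytic_at f s" "right_analytic_at g s"
  shows "right_analytic_at (\<lambda>t. f t - g t) s"
proof -
  obtain \<delta> a where 1: "\<delta> > 0" "\<And>t. t \<in> {s..<s + \<delta>} \<Longrightarrow> (\<lambda>i. a i * (t - s) ^ i) sums f t"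
    using assms(1) unfolding right_analytic_at_def by blast
  obtain \<epsilon> b where 2: "\<epsilon> > 0" "\<And>t. t \<in> {s..<s + \<epsilon>} \<Longrightarrow> (\<lambda>i. b i * (t - s) ^ i) sums g t"
    using assms(2) unfolding right_analytic_at_def by blast
  have "(\<lambda>i. (a i - b i) * (t - s) ^ i) sums (f t - g t)" if "t \<in> {s..<s + min \<delta> \<epsilon>}" for t
  proof -
    have "t \<in> {s..<s + \<delta>}" "t \<in> {s..<s + \<epsilon>}"
      using that by auto
    from sums_diff[OF 1(2)[OF this(1)] 2(2)[OF this(2)]] show ?thesis
      by (simp add: left_diff_distrib)
  qed
  then show ?thesis
    unfolding right_analytic_at_def using 1(1) 2(1)
    by (intro exI[of _ "min \<delta> \<epsilon>"] conjI exI[of _ "\<lambda>i. a i - b i"]) auto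
qed

section \<open>Measurability and growth\<close>

text \<open>
  A right continuous function is the pointwise limit of the step functions that sample it at the next
  grid point strictly to the right.
\<close>

lemma right_continuous_borel_measurable:
  fixes f :: "real \<Rightarrow> real"
  assumes "\<And>s. s \<ge> 0 \<Longrightarrow> (f \<longlongrightarrow> f s) (at_right s)"
  shows "set_borel_measurable borel {0..} f"
proof -
  define d where "d n x = (of_int \<lfloor>real (Suc n) * x\<rfloor> + 1) / real (Suc n)" for n x
  have d_gt: "d n x > x" for n x
    unfolding d_def by (simp add: field_simps) linarith
  have d_le: "d n x \<le> x + 1 / real (Suc n)" for n x
  proof -
    have "(of_int \<lfloor>real (Suc n) * x\<rfloor> + 1) / real (Suc n) \<le> (real (Suc n) * x + 1) / real (Suc n)"
      by (intro divide_right_mono add_right_mono of_int_floor_le) simp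
    also have "\<dots> = x + 1 / real (Suc n)"
      by (simp add: add_divide_distrib del: of_nat_Suc)
    finally show ?thesis by (simp add: d_def)
  qed
  have d_lim: "(\<lambda>n. d n x) \<longlonglongrightarrow> x" for x
  proof (rule tendsto_sandwich[of "\<lambda>_. x" _ _ "\<lambda>n. x + 1 / real (Suc n)"])
    show "(\<lambda>n. x + 1 / real (Suc n)) \<longlonglongrightarrow> x"
      using tendsto_add[OF tendsto_const[of x] LIMSEQ_inverse_real_of_nat]
      by (simp add: inverse_eq_divide)
  qed (use d_gt d_le in \<open>auto intro!: always_eventually less_imp_le\<close>)
  have d_filter: "filterlim (\<lambda>n. d n x) (at_right x) sequentially" for x
    using d_lim[of x] d_gt[of x] by (simp add: filterlim_at less_imp_neq[symmetric] always_eventually)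
  have "(\<lambda>x. indicator {0..} x *\<^sub>R f x) \<in> borel_measurable borel"
  proof (rule borel_measurable_LIMSEQ_real)
    show "(\<lambda>n. indicator {0..} x *\<^sub>R f (d n x)) \<longlonglongrightarrow> indicator {0..} x *\<^sub>R f x" for x
      using filterlim_compose[OF assms d_filter, of x] by (cases "x \<ge> 0") auto
    show "(\<lambda>x. indicator {0..} x *\<^sub>R f (d n x)) \<in> borel_measurable borel" for n
    proof -
      have "(\<lambda>x. \<lfloor>real (Suc n) * x\<rfloor>) \<in> borel \<rightarrow>\<^sub>M count_space UNIV"
        by measurable
      from measurable_compose[OF this, of "\<lambda>j. f ((of_int j + 1) / real (Suc n))" borel]
      have "(\<lambda>x. f (d n x)) \<in> borel_measurable borel"
        unfolding d_def by simp
      then show ?thesis by measurable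
    qed
  qed
  then show ?thesis
    by (simp add: set_borel_measurable_def)
qed

lemma set_borel_measurable_power:
  fixes f :: "'a \<Rightarrow> real"
  assumes "set_borel_measurable M A f" "A \<in> sets M"
  shows "set_borel_measurable M A (\<lambda>x. f x ^ j)"
proof -
  have "(\<lambda>x. indicator A x * (indicator A x *\<^sub>R f x) ^ j) \<in> borel_measurable M"
    using assms unfolding set_borel_measurable_def by measurable
  also have "(\<lambda>x. indicator A x * (indicator A x *\<^sub>R f x) ^ j) = (\<lambda>x. indicator A x *\<^sub>R f x ^ j)"
    by (auto simp: fun_eq_iff indicator_def)
  finally show ?thesis by (simp add: set_borel_measurable_def)
qed

lemma set_borel_measurable_diff:
  fixes f g :: "'a \<Rightarrow> real"
  assumes "set_borel_measurable M A f" "set_borel_measurable M A g"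
  shows "set_borel_measurable M A (\<lambda>x. f x - g x)"
  using borel_measurable_diff[of _ M, OF assms[unfolded set_borel_measurable_def]]
  by (simp add: set_borel_measurable_def right_diff_distrib)

lemma exponential_order_mult:
  assumes "exponential_order f" "exponential_order g"
  shows "exponential_order (\<lambda>x. f x * g x)"
proof -
  obtain c C where 1: "c > 0" "C > 0" "\<And>x. x \<ge> 0 \<Longrightarrow> \<bar>f x\<bar> \<le> C * exp (c * x)"
    using assms(1) unfolding exponential_order_def by blast
  obtain d D where 2: "d > 0" "D > 0" "\<And>x. x \<ge> 0 \<Longrightarrow> \<bar>g x\<bar> \<le> D * exp (d * x)"
    using assms(2) unfolding exponential_order_def by blast
  have "\<bar>f x * g x\<bar> \<le> (C * D) * exp ((c + d) * x)" if "x \<ge> 0" for x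
    using mult_mono[OF 1(3)[OF that] 2(3)[OF that]] 1(2)
    unfolding distrib_right exp_add abs_mult by (simp add: mult_ac)
  then show ?thesis
    unfolding exponential_order_def using 1 2 by (intro exI[of _ "c + d"] conjI exI[of _ "C * D"]) auto
qed

lemma exponential_order_power:
  assumes "exponential_order f"
  shows "exponential_order (\<lambda>x. f x ^ j)"
proof (induction j)
  case 0
  have "\<forall>x\<ge>0. \<bar>1 :: real\<bar> \<le> 1 * exp (1 * x)" by simp
  then show ?case
    unfolding exponential_order_def power_0 by (intro exI[of _ 1] conjI) auto
next
  case (Suc j)
  then show ?case
    using exponential_order_mult[OF assms] by simp
qed

lemma exponential_order_diff:
  assumes "exponential_order f" "exponential_order g"
  shows "exponential_order (\<lambda>x. f x - g x)"
proof -
  obtain c C where 1: "c > 0" "C > 0" "\<And>x. x \<ge> 0 \<Longrightarrow> \<bar>f x\<bar> \<le> C * exp (c * x)"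
    using assms(1) unfolding exponential_order_def by blast
  obtain d D where 2: "d > 0" "D > 0" "\<And>x. x \<ge> 0 \<Longrightarrow> \<bar>g x\<bar> \<le> D * exp (d * x)"
    using assms(2) unfolding exponential_order_def by blast
  have "\<bar>f x - g x\<bar> \<le> (C + D) * exp ((c + d) * x)" if "x \<ge> 0" for x
  proof -
    have "C * exp (c * x) \<le> C * exp ((c + d) * x)" "D * exp (d * x) \<le> D * exp ((c + d) * x)"
      using 1 2 that by (auto intro!: mult_left_mono mult_right_mono)
    then show ?thesis
      using 1(3)[OF that] 2(3)[OF that] by (simp add: distrib_right)
  qed
  then show ?thesis
    unfolding exponential_order_def using 1 2 by (intro exI[of _ "c + d"] conjI exI[of _ "C + D"]) auto
qed

section \<open>The leading term of Watson's lemma\<close>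

definition real_laplace :: "(real \<Rightarrow> real) \<Rightarrow> real \<Rightarrow> real" where
  "real_laplace h l = (LINT x:{0..}|lborel. exp (- l * x) * h x)"

lemma laplace_of_real: "laplace h (complex_of_real l) = complex_of_real (real_laplace h l)"
  unfolding laplace_def real_laplace_def set_integral_complex_of_real[symmetric]
  by (simp add: exp_of_real[symmetric])

lemma has_bochner_integral_power_times_exp:
  "has_bochner_integral lborel (\<lambda>x::real. indicator {0..} x * (x ^ k * exp (- x))) (fact k)"
proof (rule has_bochner_integral_nn_integral)
  have "(\<integral>\<^sup>+ x. ennreal (indicator {0..} x * (x ^ k * exp (- x))) \<partial>lborel)
      = (\<integral>\<^sup>+ x. ennreal (x ^ k * exp (- x)) * indicator {0..} x \<partial>lborel)"
    by (intro nn_integral_cong) (auto simp: indicator_def)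
  then show "(\<integral>\<^sup>+ x. ennreal (indicator {0..} x * (x ^ k * exp (- x))) \<partial>lborel) = ennreal (fact k)"
    by (simp add: nn_intergal_power_times_exp_Ici)
qed (auto simp: indicator_def)

text \<open>
  Half of the exponential decay is kept for the dominating function; the other half absorbs the
  exponential growth of the transformed function.
\<close>

lemma integrable_power_times_exp_half:
  "integrable lborel (\<lambda>x::real. indicator {0..} x * (x ^ k * exp (- (x / 2))))"
proof -
  have "integrable lborel (\<lambda>x::real. indicator {0..} x * (x ^ k * exp (- x)))"
    using has_bochner_integral_power_times_exp by (rule integrable.intros)
  from lborel_integrable_real_affine[OF this, of "1/2" 0]
  have "integrable lborel (\<lambda>x::real. indicator {0..} (x/2) * ((x/2) ^ k * exp (- (x/2))))"
    by simp
  then have "integrable lborel (\<lambda>x::real. 2 ^ k * (indicator {0..} (x/2) * ((x/2) ^ k * exp (- (x/2)))))"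
    by (intro integrable_mult_right)
  also have "(\<lambda>x::real. 2 ^ k * (indicator {0..} (x/2) * ((x/2) ^ k * exp (- (x/2)))))
      = (\<lambda>x::real. indicator {0..} x * (x ^ k * exp (- (x / 2))))"
    by (auto simp: fun_eq_iff indicator_def power_divide)
  finally show ?thesis .
qed

lemma real_laplace_diff:
  assumes "set_borel_measurable borel {0..} f" "exponential_order f"
    and "set_borel_measurable borel {0..} g" "exponential_order g"
  shows "\<forall>\<^sub>F l in at_top. real_laplace (\<lambda>x. f x - g x) l = real_laplace f l - real_laplace g l"
proof -
  have integrable: "\<forall>\<^sub>F l in at_top. set_integrable lborel {0..} (\<lambda>x. exp (- l * x) * h x)"
    if meas: "set_borel_measurable borel {0..} h" and "exponential_order h" for h :: "real \<Rightarrow> real"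
  proof -
    obtain c C where c: "c > 0" "C > 0" "\<And>x. x \<ge> 0 \<Longrightarrow> \<bar>h x\<bar> \<le> C * exp (c * x)"
      using \<open>exponential_order h\<close> unfolding exponential_order_def by blast
    have "set_integrable lborel {0..} (\<lambda>x. exp (- l * x) * h x)" if "l \<ge> c + 1" for l
    proof (rule set_integrable_bound)
      show "set_integrable lborel {0..} (\<lambda>x::real. C * exp (- (x / 2)))"
        using integrable_mult_right[OF integrable_power_times_exp_half[of 0], of C]
        by (simp add: set_integrable_def mult_ac)
      have "(\<lambda>x. exp (- l * x) * (indicator {0..} x *\<^sub>R h x)) \<in> borel_measurable borel"
        using meas unfolding set_borel_measurable_def by measurable
      then show "set_borel_measurable lborel {0..} (\<lambda>x. exp (- l * x) * h x)"
        by (simp add: set_borel_measurable_def mult_ac)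
      have "norm (exp (- l * x) * h x) \<le> norm (C * exp (- (x / 2)))" if "x \<ge> 0" for x
      proof -
        have "c * x + x / 2 \<le> l * x"
          using mult_right_mono[OF \<open>l \<ge> c + 1\<close> \<open>x \<ge> 0\<close>] \<open>x \<ge> 0\<close> by (simp add: distrib_right)
        then have "exp (- l * x) * exp (c * x) \<le> exp (- (x / 2))"
          unfolding exp_add[symmetric] by simp
        then have "C * (exp (- l * x) * exp (c * x)) \<le> C * exp (- (x / 2))"
          using c(2) by (intro mult_left_mono) auto
        moreover have "exp (- l * x) * \<bar>h x\<bar> \<le> exp (- l * x) * (C * exp (c * x))"
          using c(3)[OF that] by (intro mult_left_mono) auto
        moreover have "exp (- l * x) * (C * exp (c * x)) = C * (exp (- l * x) * exp (c * x))"
          by (rule mult.left_commute)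
        ultimately have "exp (- l * x) * \<bar>h x\<bar> \<le> C * exp (- (x / 2))"
          by linarith
        then show ?thesis
          using c(2) by (simp add: abs_mult)
      qed
      then show "AE x in lborel. x \<in> {0..} \<longrightarrow> norm (exp (- l * x) * h x) \<le> norm (C * exp (- (x / 2)))"
        by simp
    qed
    then show ?thesis
      using eventually_ge_at_top[of "c + 1"] by (rule eventually_mono[rotated])
  qed
  show ?thesis
    using integrable[OF assms(1,2)] integrable[OF assms(3,4)]
  proof eventually_elim
    case (elim l)
    then show ?case
      unfolding real_laplace_def by (simp add: right_diff_distrib)
  qed
qed

text \<open>
  The limit controls \<open>h\<close> near \<open>s\<close> and the exponential order controls it elsewhere. The factor \<open>v ^ k\<close>
  must be present in the global bound: after the rescaling below it cancels the growing factor
  \<open>l ^ k\<close>, which makes domination uniform in \<open>l\<close> possible.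
\<close>

lemma power_exp_bound_of_leading_term:
  assumes "exponential_order h"
    and lim: "((\<lambda>t. h t / (t - s) ^ k) \<longlongrightarrow> F) (at_right s)" and "s \<ge> 0"
  obtains c D where "c > 0" "D > 0" "\<And>v. v > 0 \<Longrightarrow> \<bar>h (s + v)\<bar> \<le> D * v ^ k * exp (c * v)"
proof -
  obtain c C where c: "c > 0" "C > 0" "\<And>x. x \<ge> 0 \<Longrightarrow> \<bar>h x\<bar> \<le> C * exp (c * x)"
    using assms(1) unfolding exponential_order_def by blast
  have "\<forall>\<^sub>F t in at_right s. \<bar>h t / (t - s) ^ k\<bar> < \<bar>F\<bar> + 1"
    using tendsto_rabs[OF lim] by (rule order_tendstoD) simp
  then obtain b where b: "b > s" "\<And>t. s < t \<Longrightarrow> t < b \<Longrightarrow> \<bar>h t / (t - s) ^ k\<bar> < \<bar>F\<bar> + 1"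
    unfolding eventually_at_right_field by blast
  define \<delta> where "\<delta> = b - s"
  have "\<delta> > 0" using b by (simp add: \<delta>_def)
  define D where "D = max (\<bar>F\<bar> + 1) (C * exp (c * s) / \<delta> ^ k)"
  have "D > 0" by (simp add: D_def less_max_iff_disj add_nonneg_pos)
  moreover have "\<bar>h (s + v)\<bar> \<le> D * v ^ k * exp (c * v)" if "v > 0" for v
  proof (cases "v < \<delta>")
    case True
    then have "\<bar>h (s + v)\<bar> \<le> (\<bar>F\<bar> + 1) * v ^ k"
      using b(2)[of "s + v"] that by (simp add: \<delta>_def abs_divide divide_less_eq power_abs)
    also have "\<dots> \<le> D * v ^ k"
      using that by (intro mult_right_mono) (auto simp: D_def)
    also have "\<dots> \<le> D * v ^ k * exp (c * v)"
      using \<open>D > 0\<close> c(1) that mult_left_mono[of 1 "exp (c * v)" "D * v ^ k"] by simp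
    finally show ?thesis .
  next
    case False
    have "\<bar>h (s + v)\<bar> \<le> (C * exp (c * s) / \<delta> ^ k) * \<delta> ^ k * exp (c * v)"
      using c(3)[of "s + v"] that \<open>s \<ge> 0\<close> \<open>\<delta> > 0\<close> by (simp add: distrib_left exp_add mult_ac)
    also have "\<dots> \<le> D * v ^ k * exp (c * v)"
      using False \<open>\<delta> > 0\<close> \<open>D > 0\<close>
      by (intro mult_right_mono mult_mono power_mono) (auto simp: D_def)
    finally show ?thesis .
  qed
  ultimately show thesis
    using that c(1) by blast
qed

text \<open>The substitution \<open>x = s + u / l\<close> moves the dependence on \<open>l\<close> into the argument of \<open>h\<close>.\<close>

lemma real_laplace_rescale:
  assumes "l > 0" "s \<ge> 0" and vanish: "\<And>x. 0 \<le> x \<Longrightarrow> x < s \<Longrightarrow> h x = 0"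
  shows "l * exp (l * s) * real_laplace h l
    = (\<integral>u. indicator {0..} u * (exp (- u) * h (s + u / l)) \<partial>lborel)"
proof -
  let ?f = "\<lambda>x. indicator {0..} x * (exp (- l * x) * h x)"
  have "real_laplace h l = (1 / l) * (\<integral>u. ?f (s + u / l) \<partial>lborel)"
    using lborel_integral_real_affine[of "1 / l" ?f s] \<open>l > 0\<close>
    by (simp add: real_laplace_def set_lebesgue_integral_def)
  also have "(\<lambda>u. ?f (s + u / l))
      = (\<lambda>u. exp (- l * s) * (indicator {0..} u * (exp (- u) * h (s + u / l))))"
  proof
    fix u
    show "?f (s + u / l) = exp (- l * s) * (indicator {0..} u * (exp (- u) * h (s + u / l)))"
    proof (cases "u \<ge> 0")
      case True
      have "exp (- l * (s + u / l)) = exp (- l * s) * exp (- u)"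
        using \<open>l > 0\<close> by (simp add: exp_add[symmetric] distrib_left)
      then show ?thesis
        using True assms by (simp add: mult_ac)
    next
      case False
      then have "u / l < 0"
        using \<open>l > 0\<close> by (simp add: divide_less_0_iff)
      then show ?thesis
        using False vanish[of "s + u / l"] by (auto simp: indicator_def)
    qed
  qed
  finally show ?thesis
    using \<open>l > 0\<close> by (simp add: exp_minus)
qed

text \<open>
  After rescaling, \<open>l ^ k * h (s + u / l)\<close> tends to \<open>F * u ^ k\<close> for every \<open>u > 0\<close>, and dominated
  convergence turns the integral into Euler's integral for \<open>fact k\<close>.
\<close>

lemma real_laplace_leading_term:
  assumes meas: "set_borel_measurable borel {0..} h" and exp_order: "exponential_order h"
    and "s \<ge> 0" and vanish: "\<And>x. 0 \<le> x \<Longrightarrow> x < s \<Longrightarrow> h x = 0"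
    and lim: "((\<lambda>t. h t / (t - s) ^ k) \<longlongrightarrow> F) (at_right s)"
  shows "((\<lambda>l. l ^ Suc k * exp (l * s) * real_laplace h l) \<longlongrightarrow> F * fact k) at_top"
proof -
  obtain c D where c: "c > 0" "D > 0" "\<And>v. v > 0 \<Longrightarrow> \<bar>h (s + v)\<bar> \<le> D * v ^ k * exp (c * v)"
    using power_exp_bound_of_leading_term[OF exp_order lim \<open>s \<ge> 0\<close>] by metis
  define I where "I l u = l ^ k * (indicator {0..} u * (exp (- u) * h (s + u / l)))" for l u
  \<comment> \<open>The value \<open>h s\<close> is unrelated to the limit, so \<open>u = 0\<close> has to be discarded.\<close>
  have not_zero: "AE u in lborel. u \<noteq> (0::real)"
    by (rule AE_lborel_singleton)
  \<comment> \<open>With \<open>max 1 l\<close> the argument \<open>s + u / l\<close> stays in the half-line where \<open>h\<close> is measurable.\<close>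
  have limit: "((\<lambda>l. integral\<^sup>L lborel (I (max 1 l)))
      \<longlongrightarrow> (\<integral>u. F * (indicator {0..} u * (u ^ k * exp (- u))) \<partial>lborel)) at_top"
  proof (rule integral_dominated_convergence_at_top)
    show "integrable lborel (\<lambda>u. D * (indicator {0..} u * (u ^ k * exp (- (u / 2)))))"
      by (intro integrable_mult_right integrable_power_times_exp_half)
    show "I (max 1 l) \<in> borel_measurable lborel" for l
    proof -
      define m where "m = max 1 l"
      have "m > 0" by (simp add: m_def)
      have [measurable]: "(\<lambda>x. indicator {0..} x *\<^sub>R h x) \<in> borel_measurable borel"
        using meas by (simp add: set_borel_measurable_def)
      have "(\<lambda>u. m ^ k * (indicator {0..} u * (exp (- u) *
          (indicator {0..} (s + u / m) *\<^sub>R h (s + u / m))))) \<in> borel_measurable lborel"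
        by measurable
      also have "(\<lambda>u. m ^ k * (indicator {0..} u * (exp (- u) *
          (indicator {0..} (s + u / m) *\<^sub>R h (s + u / m))))) = I m"
        using \<open>m > 0\<close> \<open>s \<ge> 0\<close> by (auto simp: fun_eq_iff I_def indicator_def)
      finally show ?thesis by (simp add: m_def)
    qed
    have "norm (I (max 1 l) u) \<le> D * (indicator {0..} u * (u ^ k * exp (- (u / 2))))"
      if "l \<ge> max 1 (2 * c)" "u \<noteq> 0" for l u
    proof (cases "u > 0")
      case True
      have l: "l \<ge> 1" "l \<ge> 2 * c" "max 1 l = l" using that by auto
      have "l ^ k * \<bar>h (s + u / l)\<bar> \<le> l ^ k * (D * (u / l) ^ k * exp (c * (u / l)))"
        using c(3)[of "u / l"] True l by (intro mult_left_mono) auto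
      also have "\<dots> = D * u ^ k * exp (c * (u / l))"
        using l by (simp add: power_divide)
      also have "\<dots> \<le> D * u ^ k * exp (u / 2)"
      proof -
        have "c * (u / l) \<le> u / 2"
          using l c(1) True mult_right_mono[of "2 * c" l u] by (simp add: field_simps)
        then show ?thesis
          using c(2) True by (intro mult_left_mono) auto
      qed
      finally have "exp (- u) * (l ^ k * \<bar>h (s + u / l)\<bar>) \<le> exp (- u) * (D * u ^ k * exp (u / 2))"
        by (intro mult_left_mono) auto
      also have "\<dots> = D * (u ^ k * (exp (- u) * exp (u / 2)))"
        by (simp add: mult_ac)
      also have "exp (- u) * exp (u / 2) = exp (- (u / 2))"
        unfolding exp_add[symmetric] by simp
      finally show ?thesis
        using True l by (simp add: I_def abs_mult mult_ac)
    next
      case False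
      then show ?thesis using that by (simp add: I_def)
    qed
    then show "\<forall>\<^sub>F l in at_top. AE u in lborel.
        norm (I (max 1 l) u) \<le> D * (indicator {0..} u * (u ^ k * exp (- (u / 2))))"
      using not_zero by (intro eventually_at_top_linorderI[of "max 1 (2 * c)"]) auto
    have "((\<lambda>l. I (max 1 l) u) \<longlongrightarrow> F * (indicator {0..} u * (u ^ k * exp (- u)))) at_top"
      if "u \<noteq> 0" for u
    proof (cases "u > 0")
      case True
      have "filterlim (\<lambda>l. s + u / l) (at_right s) at_top"
      proof -
        have "((\<lambda>l. s + u / l) \<longlongrightarrow> s + 0) at_top"
          by (intro tendsto_add tendsto_const real_tendsto_divide_at_top[OF tendsto_const] filterlim_ident)
        moreover have "\<forall>\<^sub>F l in at_top. s + u / l > s"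
          using eventually_gt_at_top[of 0] by eventually_elim (use True in simp)
        ultimately show ?thesis
          by (auto simp: filterlim_at elim: eventually_mono)
      qed
      from filterlim_compose[OF lim this]
      have "((\<lambda>l. u ^ k * exp (- u) * (h (s + u / l) / (s + u / l - s) ^ k))
          \<longlongrightarrow> u ^ k * exp (- u) * F) at_top"
        by (intro tendsto_mult tendsto_const)
      moreover have "\<forall>\<^sub>F l in at_top.
          u ^ k * exp (- u) * (h (s + u / l) / (s + u / l - s) ^ k) = I (max 1 l) u"
        using eventually_ge_at_top[of 1]
        by eventually_elim (use True in \<open>simp add: I_def power_divide max_def\<close>)
      ultimately show ?thesis
        using True by (simp add: mult_ac Lim_transform_eventually)
    next
      case False
      then show ?thesis using that by (simp add: I_def)
    qed
    then show "AE u in lborel. ((\<lambda>l. I (max 1 l) u)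
        \<longlongrightarrow> F * (indicator {0..} u * (u ^ k * exp (- u)))) at_top"
      using not_zero by auto
  qed simp
  have limit_value: "(\<integral>u. F * (indicator {0..} u * (u ^ k * exp (- u))) \<partial>lborel) = F * fact k"
    using has_bochner_integral_power_times_exp[of k] by (simp add: has_bochner_integral_iff)
  have "\<forall>\<^sub>F l in at_top.
      integral\<^sup>L lborel (I (max 1 l)) = l ^ Suc k * exp (l * s) * real_laplace h l"
    using eventually_ge_at_top[of 1]
  proof eventually_elim
    case (elim l)
    then have "integral\<^sup>L lborel (I (max 1 l)) = l ^ k * (l * exp (l * s) * real_laplace h l)"
      using real_laplace_rescale[of l s h, OF _ \<open>s \<ge> 0\<close> vanish] by (simp add: I_def[abs_def] max_def)
    then show ?case by simp
  qed
  from Lim_transform_eventually[OF limit this] show ?thesis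
    by (simp only: limit_value)
qed

section \<open>Divided differences of powers\<close>

text \<open>
  The quotient \<open>(a ^ j - b ^ j) / (a - b)\<close>, written as a polynomial so that it is continuous and
  keeps its meaning, a derivative, on the diagonal.
\<close>

definition power_divided_difference :: "nat \<Rightarrow> real \<Rightarrow> real \<Rightarrow> real" where
  "power_divided_difference j a b = (\<Sum>i<j. b ^ (j - Suc i) * a ^ i)"

lemma power_diff_eq_divided_difference:
  "a ^ j - b ^ j = (a - b) * power_divided_difference j a b"
  by (simp add: power_divided_difference_def power_diff_sumr2)

lemma power_divided_difference_diag:
  assumes "j > 0"
  shows "power_divided_difference j a a = real j * a ^ (j - 1)"
proof -
  have "a ^ (j - Suc i) * a ^ i = a ^ (j - 1)" if "i < j" for i
    using that by (simp add: power_add[symmetric])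
  then show ?thesis
    by (simp add: power_divided_difference_def)
qed

text \<open>
  The derivative \<open>x ^ (m - 1) * (n * x ^ (n - m) - m)\<close> of \<open>x ^ n - x ^ m\<close> is positive beyond its zero
  \<open>x0\<close>.
\<close>

lemma power_diff_strict_mono_beyond_critical:
  fixes x0 a b :: real
  assumes "0 < m" "m < n" "0 < x0" "x0 ^ (n - m) = real m / real n" "x0 \<le> a" "a < b"
  shows "a ^ n - a ^ m < b ^ n - b ^ m"
    and "real m * b ^ (m - 1) < real n * b ^ (n - 1)"
proof -
  have deriv_pos: "real m * x ^ (m - 1) < real n * x ^ (n - 1)" if "x > x0" for x
  proof -
    have "x0 ^ (n - m) < x ^ (n - m)"
      using that assms by (intro power_strict_mono) auto
    then have "real m < real n * x ^ (n - m)"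
      using assms by (simp add: field_simps)
    then have "real m * x ^ (m - 1) < (real n * x ^ (n - m)) * x ^ (m - 1)"
      using that assms by (intro mult_strict_right_mono) auto
    also have "\<dots> = real n * x ^ (n - 1)"
      using assms by (simp add: power_add[symmetric])
    finally show ?thesis .
  qed
  show "real m * b ^ (m - 1) < real n * b ^ (n - 1)"
    using deriv_pos assms by simp
  show "a ^ n - a ^ m < b ^ n - b ^ m"
  proof (rule DERIV_pos_imp_increasing_open[OF \<open>a < b\<close>])
    fix x assume "a < x" "x < b"
    then have "real n * x ^ (n - 1) - real m * x ^ (m - 1) > 0"
      using deriv_pos[of x] assms by simp
    moreover have "((\<lambda>x. x ^ n - x ^ m) has_real_derivative
        real n * x ^ (n - 1) - real m * x ^ (m - 1)) (at x)"
      by (auto intro!: derivative_eq_intros)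
    ultimately show "\<exists>y. ((\<lambda>x. x ^ n - x ^ m) has_real_derivative y) (at x) \<and> 0 < y"
      by blast
  qed (intro continuous_intros)
qed

text \<open>
  With \<open>\<phi> x = x ^ n - x ^ m = x ^ m * (x ^ (n - m) - 1)\<close>, equality of the divided differences forces
  \<open>\<phi> a = \<phi> b\<close>. The signs of \<open>\<phi>\<close> reduce the last two cases to the first: \<open>\<phi>\<close> is negative on the open
  unit interval, and if \<open>n\<close> is odd and \<open>m\<close> even it is nowhere positive on the negative half-line. In
  the first case strict monotonicity gives \<open>a = b\<close>, where equality would mean \<open>\<phi>' a = 0\<close>.
\<close>

lemma power_divided_differences_differ:
  fixes x0 a b :: real
  assumes nm: "0 < m" "m < n" and x0: "0 < x0" "x0 < 1" "x0 ^ (n - m) = real m / real n"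
    and cond: "(a > x0 \<and> b \<ge> x0) \<or> (a \<ge> 1 \<and> b > 0) \<or> (odd n \<and> even m \<and> a > 1)"
  shows "power_divided_difference n a b \<noteq> power_divided_difference m a b"
proof
  assume eq: "power_divided_difference n a b = power_divided_difference m a b"
  then have phi: "a ^ n - a ^ m = b ^ n - b ^ m"
    using power_diff_eq_divided_difference[of a n b] power_diff_eq_divided_difference[of a m b]
    by simp
  have factor: "x ^ n - x ^ m = x ^ m * (x ^ (n - m) - 1)" for x :: real
    using nm by (simp add: right_diff_distrib power_add[symmetric])
  have "a > x0 \<and> b \<ge> x0"
  proof -
    have "b \<ge> 1" if "a \<ge> 1" "b > 0"
    proof (rule ccontr)
      assume "\<not> b \<ge> 1"
      then have "b ^ m * (b ^ (n - m) - 1) < 0"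
        using that nm by (intro mult_pos_neg) (auto simp: power_less_one_iff)
      moreover have "a ^ m * (a ^ (n - m) - 1) \<ge> 0"
        using that by (intro mult_nonneg_nonneg) auto
      ultimately show False using phi factor by simp
    qed
    moreover have "b > 0" if "odd n" "even m" "a > 1"
    proof (rule ccontr)
      assume "\<not> b > 0"
      then have "b ^ n - b ^ m \<le> 0"
        using that zero_le_power_eq[of b m] power_le_zero_eq[of b n] nm by auto
      moreover have "a ^ m * (a ^ (n - m) - 1) > 0"
        using that nm by (intro mult_pos_pos) (auto intro!: one_less_power)
      ultimately show False using phi factor by simp
    qed
    ultimately show ?thesis using cond x0 by fastforce
  qed
  moreover have "a = b"
    using power_diff_strict_mono_beyond_critical(1)[OF nm x0(1,3), of a b]
      power_diff_strict_mono_beyond_critical(1)[OF nm x0(1,3), of b a] phi calculation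
    by linarith
  ultimately show False
    using eq power_diff_strict_mono_beyond_critical(2)[OF nm x0(1,3) order.refl, of a] nm
    by (simp add: power_divided_difference_diag)
qed

section \<open>Comparing asymptotics\<close>

lemma first_point_where_nonzero:
  fixes f :: "real \<Rightarrow> real"
  assumes "\<exists>x\<ge>0. f x \<noteq> 0"
  obtains s where "s \<ge> 0" "\<And>x. 0 \<le> x \<Longrightarrow> x < s \<Longrightarrow> f x = 0"
    "\<And>\<epsilon>. \<epsilon> > 0 \<Longrightarrow> \<exists>t\<in>{s..<s + \<epsilon>}. f t \<noteq> 0"
proof
  let ?S = "{x. x \<ge> 0 \<and> f x \<noteq> 0}"
  have bdd: "bdd_below ?S" by (auto intro!: bdd_belowI[of _ 0])
  have ne: "?S \<noteq> {}" using assms by auto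
  show "Inf ?S \<ge> 0" using ne by (intro cInf_greatest) auto
  show "f x = 0" if "0 \<le> x" "x < Inf ?S" for x
    using cInf_lower[OF _ bdd, of x] that by force
  show "\<exists>t\<in>{Inf ?S..<Inf ?S + \<epsilon>}. f t \<noteq> 0" if "\<epsilon> > 0" for \<epsilon>
  proof -
    obtain t where "t \<in> ?S" "t < Inf ?S + \<epsilon>"
      using cInf_less_iff[OF ne bdd, of "Inf ?S + \<epsilon>"] \<open>\<epsilon> > 0\<close> by auto
    then show ?thesis using cInf_lower[OF _ bdd, of t] by auto
  qed
qed

lemma first_nonzero_0_imp_nonzero_near_0:
  assumes "first_nonzero f = 0" "\<epsilon> > 0"
  shows "\<exists>t\<in>{0..<0 + \<epsilon>}. f t \<noteq> 0"
proof (rule ccontr)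
  assume "\<not> ?thesis"
  then have "ereal \<epsilon> \<le> first_nonzero f"
    unfolding first_nonzero_def by (intro Inf_greatest) (auto simp: not_less[symmetric])
  then show False using assms by simp
qed

lemma real_laplace_power_leading_term:
  assumes "right_analytic f" "exponential_order f"
    and "((\<lambda>t. f t / t ^ k) \<longlongrightarrow> c) (at_right 0)"
  shows "((\<lambda>l. l ^ Suc (k * j) * real_laplace (\<lambda>x. f x ^ j) l) \<longlongrightarrow> c ^ j * fact (k * j)) at_top"
proof -
  have "((\<lambda>t. f t ^ j / (t - 0) ^ (k * j)) \<longlongrightarrow> c ^ j) (at_right 0)"
    using tendsto_power[OF assms(3), of j] by (simp add: power_divide power_mult)
  moreover have "set_borel_measurable borel {0..} (\<lambda>x. f x ^ j)"
    using assms(1) by (intro set_borel_measurable_power right_continuous_borel_measurable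
        right_analytic_at_tendsto) (auto simp: right_analytic_def)
  ultimately show ?thesis
    using real_laplace_leading_term[of "\<lambda>x. f x ^ j" 0 "k * j" "c ^ j"]
      exponential_order_power[OF assms(2), of j] by simp
qed

lemma eventually_real_laplace_power_nonzero:
  assumes "right_analytic f" "exponential_order f"
    and "((\<lambda>t. f t / t ^ k) \<longlongrightarrow> c) (at_right 0)" "c \<noteq> 0"
  shows "\<forall>\<^sub>F l in at_top. real_laplace (\<lambda>x. f x ^ j) l \<noteq> 0"
proof -
  have "\<forall>\<^sub>F l in at_top. l ^ Suc (k * j) * real_laplace (\<lambda>x. f x ^ j) l \<noteq> 0"
    using \<open>c \<noteq> 0\<close>
    by (intro tendsto_imp_eventually_ne[OF real_laplace_power_leading_term[OF assms(1-3)]]) simp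
  then show ?thesis by eventually_elim auto
qed

text \<open>
  The two sides of the cross-multiplied identity have exact orders \<open>l ^ - (k m + 2)\<close> and
  \<open>l ^ - (k n + 2)\<close>. As \<open>m < n\<close>, these agree only for \<open>k = 0\<close>, and then the leading coefficients
  \<open>c ^ m\<close> and \<open>c ^ n\<close> agree.
\<close>

lemma initial_value_of_laplace_power_ratio:
  assumes q: "right_analytic q" "exponential_order q"
    and p: "right_analytic p" "exponential_order p" "p 0 = 1"
    and lead: "((\<lambda>t. q t / t ^ k) \<longlongrightarrow> c) (at_right 0)" "c \<noteq> 0"
    and "m < n"
    and cross: "\<forall>\<^sub>F l in at_top. real_laplace (\<lambda>x. p x ^ n) l * real_laplace (\<lambda>x. q x ^ m) l
      = real_laplace (\<lambda>x. p x ^ m) l * real_laplace (\<lambda>x. q x ^ n) l"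
  shows "k = 0 \<and> c ^ (n - m) = 1"
proof -
  have "right_analytic_at p 0" using p by (simp add: right_analytic_def)
  then have p_lead: "((\<lambda>t. p t / t ^ 0) \<longlongrightarrow> 1) (at_right 0)"
    using right_analytic_at_tendsto[of p 0] p by simp
  note P = real_laplace_power_leading_term[OF p(1,2) p_lead, simplified]
  note Q = real_laplace_power_leading_term[OF q lead(1)]
  \<comment> \<open>\<open>d\<close> is the gap between the two orders; the limit \<open>0 ^ d\<close> treats both \<open>d = 0\<close> and \<open>d > 0\<close>.\<close>
  define d where "d = k * n - k * m"
  have kn: "k * n = k * m + d"
    using \<open>m < n\<close> by (simp add: d_def)
  have "((\<lambda>l. inverse l ^ d *
      ((l * real_laplace (\<lambda>x. p x ^ m) l) * (l ^ Suc (k * n) * real_laplace (\<lambda>x. q x ^ n) l)))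
      \<longlongrightarrow> 0 ^ d * (1 * (c ^ n * fact (k * n)))) at_top"
    by (intro tendsto_mult tendsto_power P Q tendsto_inverse_0_at_top filterlim_ident)
  moreover have "\<forall>\<^sub>F l in at_top. inverse l ^ d *
      ((l * real_laplace (\<lambda>x. p x ^ m) l) * (l ^ Suc (k * n) * real_laplace (\<lambda>x. q x ^ n) l))
      = (l * real_laplace (\<lambda>x. p x ^ n) l) * (l ^ Suc (k * m) * real_laplace (\<lambda>x. q x ^ m) l)"
    using cross eventually_gt_at_top[of 0]
  proof eventually_elim
    case (elim l)
    have "inverse l ^ d * l ^ Suc (k * n) = l ^ Suc (k * m)"
      using elim(2) by (simp add: kn power_add power_inverse)
    then have "inverse l ^ d * ((l * real_laplace (\<lambda>x. p x ^ m) l) *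
          (l ^ Suc (k * n) * real_laplace (\<lambda>x. q x ^ n) l))
        = l * l ^ Suc (k * m) * (real_laplace (\<lambda>x. p x ^ m) l * real_laplace (\<lambda>x. q x ^ n) l)"
      by (metis (no_types, lifting) mult.assoc mult.left_commute)
    then show ?case
      using elim(1) by (simp add: mult_ac)
  qed
  ultimately have "((\<lambda>l. (l * real_laplace (\<lambda>x. p x ^ n) l) *
      (l ^ Suc (k * m) * real_laplace (\<lambda>x. q x ^ m) l)) \<longlongrightarrow> 0 ^ d * (1 * (c ^ n * fact (k * n)))) at_top"
    by (rule Lim_transform_eventually)
  moreover have "((\<lambda>l. (l * real_laplace (\<lambda>x. p x ^ n) l) *
      (l ^ Suc (k * m) * real_laplace (\<lambda>x. q x ^ m) l)) \<longlongrightarrow> 1 * (c ^ m * fact (k * m))) at_top"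
    by (intro tendsto_mult P Q)
  ultimately have eq: "0 ^ d * (c ^ n * fact (k * n)) = c ^ m * fact (k * m)"
    using tendsto_unique[OF trivial_limit_at_top_linorder] by fastforce
  then have "d = 0"
    using lead(2) by (cases d) auto
  then have "k = 0"
    using \<open>m < n\<close> by (simp add: d_def)
  moreover have "c ^ (n - m) = 1"
    using eq \<open>d = 0\<close> \<open>k = 0\<close> lead(2) \<open>m < n\<close> by (simp add: power_diff)
  ultimately show ?thesis by simp
qed

text \<open>
  The factorisation \<open>p t ^ j - q t ^ j = (p t - q t) * D j (p t) (q t)\<close> gives the coefficient of
  \<open>(t - s) ^ k\<close> in the left side for all \<open>j\<close> at once, with the same \<open>c \<noteq> 0\<close>, whether or not
  \<open>p s = q s\<close>. Since the transforms of \<open>q ^ m\<close> and \<open>q ^ n\<close> have the same leading term, the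
  cross-multiplied identity equates these coefficients for \<open>j = n\<close> and \<open>j = m\<close>.
\<close>

lemma divided_differences_agree_at_first_discrepancy:
  assumes p: "right_analytic p" "exponential_order p" "p 0 = 1"
    and q: "right_analytic q" "exponential_order q" "q 0 = 1"
    and s: "s \<ge> 0" "\<And>x. 0 \<le> x \<Longrightarrow> x < s \<Longrightarrow> p x = q x"
      "\<And>\<epsilon>. \<epsilon> > 0 \<Longrightarrow> \<exists>t\<in>{s..<s + \<epsilon>}. p t \<noteq> q t"
    and cross: "\<forall>\<^sub>F l in at_top. real_laplace (\<lambda>x. p x ^ n) l * real_laplace (\<lambda>x. q x ^ m) l
      = real_laplace (\<lambda>x. p x ^ m) l * real_laplace (\<lambda>x. q x ^ n) l"
  shows "power_divided_difference n (p s) (q s) = power_divided_difference m (p s) (q s)"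
proof -
  have at_s: "right_analytic_at p s" "right_analytic_at q s"
    using p q s by (auto simp: right_analytic_def)
  obtain k c where "c \<noteq> 0" and c: "((\<lambda>t. (p t - q t) / (t - s) ^ k) \<longlongrightarrow> c) (at_right s)"
  proof (rule right_analytic_at_leading_term[OF right_analytic_at_diff[OF at_s]])
    show "\<exists>t\<in>{s..<s + \<epsilon>}. p t - q t \<noteq> 0" if "\<epsilon> > 0" for \<epsilon>
      using s(3)[OF that] by auto
  qed
  have meas: "set_borel_measurable borel {0..} (\<lambda>x. f x ^ j)" if "right_analytic f" for f j
    using that by (intro set_borel_measurable_power right_continuous_borel_measurable
        right_analytic_at_tendsto) (auto simp: right_analytic_def)
  define A where "A j l = l ^ Suc k * exp (l * s) *
      (real_laplace (\<lambda>x. p x ^ j) l - real_laplace (\<lambda>x. q x ^ j) l)" for j l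
  have A: "(A j \<longlongrightarrow> c * power_divided_difference j (p s) (q s) * fact k) at_top" for j
  proof -
    have "((\<lambda>t. (p t - q t) / (t - s) ^ k * power_divided_difference j (p t) (q t))
        \<longlongrightarrow> c * power_divided_difference j (p s) (q s)) (at_right s)"
      unfolding power_divided_difference_def
      by (intro tendsto_mult tendsto_sum tendsto_power c right_analytic_at_tendsto at_s)
    then have "((\<lambda>t. (p t ^ j - q t ^ j) / (t - s) ^ k)
        \<longlongrightarrow> c * power_divided_difference j (p s) (q s)) (at_right s)"
      by (simp add: power_diff_eq_divided_difference)
    then have lim: "((\<lambda>l. l ^ Suc k * exp (l * s) * real_laplace (\<lambda>x. p x ^ j - q x ^ j) l)
        \<longlongrightarrow> c * power_divided_difference j (p s) (q s) * fact k) at_top"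
      using s p q by (intro real_laplace_leading_term set_borel_measurable_diff
          exponential_order_diff exponential_order_power meas) auto
    have "\<forall>\<^sub>F l in at_top.
        l ^ Suc k * exp (l * s) * real_laplace (\<lambda>x. p x ^ j - q x ^ j) l = A j l"
      using real_laplace_diff[OF meas[OF p(1), of j] exponential_order_power[OF p(2), of j]
          meas[OF q(1), of j] exponential_order_power[OF q(2), of j]]
      by eventually_elim (simp add: A_def)
    with lim show ?thesis by (rule Lim_transform_eventually)
  qed
  have "((\<lambda>t. q t / t ^ 0) \<longlongrightarrow> 1) (at_right 0)"
    using right_analytic_at_tendsto[of q 0] q by (simp add: right_analytic_def)
  note Q = real_laplace_power_leading_term[OF q(1,2) this, simplified]
  have cross_diff: "(a - b) * d = (c - d) * b" if "a * d = c * b" for a b c d :: real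
    using that by (simp add: algebra_simps)
  have "((\<lambda>l. A n l * (l * real_laplace (\<lambda>x. q x ^ m) l))
      \<longlongrightarrow> c * power_divided_difference n (p s) (q s) * fact k * 1) at_top"
    by (intro tendsto_mult[OF A Q])
  moreover have "\<forall>\<^sub>F l in at_top. A n l * (l * real_laplace (\<lambda>x. q x ^ m) l)
      = A m l * (l * real_laplace (\<lambda>x. q x ^ n) l)"
    using cross
  proof eventually_elim
    case (elim l)
    then have "(real_laplace (\<lambda>x. p x ^ n) l - real_laplace (\<lambda>x. q x ^ n) l) * real_laplace (\<lambda>x. q x ^ m) l
        = (real_laplace (\<lambda>x. p x ^ m) l - real_laplace (\<lambda>x. q x ^ m) l) * real_laplace (\<lambda>x. q x ^ n) l"
      by (rule cross_diff)
    then show ?case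
      by (simp add: A_def mult_ac)
  qed
  ultimately have "((\<lambda>l. A m l * (l * real_laplace (\<lambda>x. q x ^ n) l))
      \<longlongrightarrow> c * power_divided_difference n (p s) (q s) * fact k * 1) at_top"
    by (rule Lim_transform_eventually)
  moreover have "((\<lambda>l. A m l * (l * real_laplace (\<lambda>x. q x ^ n) l))
      \<longlongrightarrow> c * power_divided_difference m (p s) (q s) * fact k * 1) at_top"
    by (intro tendsto_mult[OF A Q])
  ultimately show ?thesis
    using tendsto_unique[OF trivial_limit_at_top_linorder] \<open>c \<noteq> 0\<close> by fastforce
qed

lemma cross_multiplied_H_eq:
  assumes "\<forall>\<^sub>F l :: real in at_top. H n m p (complex_of_real l) = H n m q (complex_of_real l)"
    and "\<forall>\<^sub>F l in at_top. real_laplace (\<lambda>x. p x ^ m) l \<noteq> 0"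
    and "\<forall>\<^sub>F l in at_top. real_laplace (\<lambda>x. q x ^ m) l \<noteq> 0"
  shows "\<forall>\<^sub>F l in at_top. real_laplace (\<lambda>x. p x ^ n) l * real_laplace (\<lambda>x. q x ^ m) l
      = real_laplace (\<lambda>x. p x ^ m) l * real_laplace (\<lambda>x. q x ^ n) l"
  using assms
proof eventually_elim
  case (elim l)
  from elim(1) have "complex_of_real (real_laplace (\<lambda>x. p x ^ n) l / real_laplace (\<lambda>x. p x ^ m) l)
      = complex_of_real (real_laplace (\<lambda>x. q x ^ n) l / real_laplace (\<lambda>x. q x ^ m) l)"
    by (simp add: H_def laplace_of_real)
  then have "real_laplace (\<lambda>x. p x ^ n) l / real_laplace (\<lambda>x. p x ^ m) l
      = real_laplace (\<lambda>x. q x ^ n) l / real_laplace (\<lambda>x. q x ^ m) l"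
    by (simp only: of_real_eq_iff)
  then show ?case
    using elim(2,3) by (simp add: field_simps)
qed

theorem theorem2p1:
  fixes n m :: nat and x0 :: real and p q :: "real \<Rightarrow> real"
  assumes "m \<ge> 1" and "n > m" and "coprime n m"
    and "x0 = (real m / real n) powr (1 / (real n - real m))"
    and "right_analytic p" and "right_analytic q"
    and "exponential_order p" and "exponential_order q"
    and "first_nonzero p = 0" and "first_nonzero q = 0"
    and "p 0 = 1"
    and "(\<forall>t>0. p t > x0 \<and> q t \<ge> x0)
       \<or> (\<forall>t>0. p t \<ge> 1 \<and> q t > 0)
       \<or> (odd n \<and> even m \<and> (\<forall>t>0. p t > 1))"
    and "\<forall>\<^sub>F l :: real in at_top. H n m p (complex_of_real l) = H n m q (complex_of_real l)"
  shows "\<forall>x\<ge>0. p x = q x"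
proof (rule ccontr)
  assume "\<not> ?thesis"
  then have "\<exists>x\<ge>0. p x - q x \<noteq> 0" by auto
  then obtain s where s: "s \<ge> 0" "\<And>x. 0 \<le> x \<Longrightarrow> x < s \<Longrightarrow> p x = q x"
    "\<And>\<epsilon>. \<epsilon> > 0 \<Longrightarrow> \<exists>t\<in>{s..<s + \<epsilon>}. p t \<noteq> q t"
    using first_point_where_nonzero[of "\<lambda>x. p x - q x"] by auto
  have nm: "0 < m" "m < n" using assms(1,2) by auto
  have "0 < x0" using nm assms(4) by simp
  have x0_power: "x0 ^ (n - m) = real m / real n"
    using nm assms(4) by (simp add: powr_realpow[symmetric] powr_powr of_nat_diff)
  have "x0 < 1"
  proof (rule ccontr)
    assume "\<not> x0 < 1"
    then have "x0 ^ (n - m) \<ge> 1" by (intro one_le_power) simp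
    then show False using x0_power nm by (simp add: field_simps)
  qed
  have at_0: "right_analytic_at p 0" "right_analytic_at q 0"
    using assms(5,6) by (auto simp: right_analytic_def)
  obtain k c where "c \<noteq> 0" and c: "((\<lambda>t. q t / t ^ k) \<longlongrightarrow> c) (at_right 0)"
    using right_analytic_at_leading_term[OF at_0(2) first_nonzero_0_imp_nonzero_near_0[OF assms(10)]]
    unfolding diff_zero by metis
  have p_lead: "((\<lambda>t. p t / t ^ 0) \<longlongrightarrow> 1) (at_right 0)"
    using right_analytic_at_tendsto[OF at_0(1)] assms(11) by simp
  have cross: "\<forall>\<^sub>F l in at_top. real_laplace (\<lambda>x. p x ^ n) l * real_laplace (\<lambda>x. q x ^ m) l
      = real_laplace (\<lambda>x. p x ^ m) l * real_laplace (\<lambda>x. q x ^ n) l"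
    using assms(13) eventually_real_laplace_power_nonzero[OF assms(5,7) p_lead one_neq_zero]
      eventually_real_laplace_power_nonzero[OF assms(6,8) c \<open>c \<noteq> 0\<close>]
    by (rule cross_multiplied_H_eq)
  have "k = 0" and c_power: "c ^ (n - m) = 1"
    using initial_value_of_laplace_power_ratio[OF assms(6,8,5,7,11) c \<open>c \<noteq> 0\<close> nm(2) cross] by auto
  then have "q 0 = c"
    using tendsto_unique[OF _ right_analytic_at_tendsto[OF at_0(2)]] c by simp
  moreover have "c = 1"
  proof -
    have "c \<ge> 0"
    proof (cases "odd n \<and> even m")
      case True
      then have "odd (n - m)" using nm by simp
      then show ?thesis
        using c_power power_le_zero_eq[of c "n - m"] nm by (cases "c \<ge> 0") auto
    next
      case False
      then have "\<forall>t>0. q t \<ge> 0"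
        using assms(12) \<open>0 < x0\<close> by force
      then have "\<forall>\<^sub>F t in at_right 0. 0 \<le> q t"
        using eventually_at_right_less[of "0::real"] by (auto elim: eventually_mono)
      then show ?thesis
        using c \<open>k = 0\<close> by (intro tendsto_lowerbound[of q c "at_right 0"]) auto
    qed
    then show ?thesis
      using c_power nm power_eq_imp_eq_base[of c "n - m" 1] by simp
  qed
  ultimately have "q 0 = 1" by simp
  \<comment> \<open>The conditions speak of positive arguments only; at \<open>s = 0\<close> the common value 1 satisfies the
      second one.\<close>
  have "(p s > x0 \<and> q s \<ge> x0) \<or> (p s \<ge> 1 \<and> q s > 0) \<or> (odd n \<and> even m \<and> p s > 1)"
  proof (cases "s = 0")
    case True
    then show ?thesis using assms(11) \<open>q 0 = 1\<close> by simp
  next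
    case False
    then show ?thesis using assms(12) s(1) by auto
  qed
  then have "power_divided_difference n (p s) (q s) \<noteq> power_divided_difference m (p s) (q s)"
    by (intro power_divided_differences_differ[OF nm \<open>0 < x0\<close> \<open>x0 < 1\<close> x0_power])
  with divided_differences_agree_at_first_discrepancy[OF assms(5,7,11,6,8) \<open>q 0 = 1\<close> s cross]
  show False by contradiction
qed

end
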